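(* Let $N\ge 1$, let $\Lambda$ be a random matrix distributed according to the Haar probability measure on the group $U(N)$ of $N\times N$ unitary matrices, and let $Z_N=\det(I-\Lambda)$. Then $$|Z_N|\ \stackrel{\text{law}}{=}\ 2^{N}\left(\prod_{j=1}^{N}\sqrt{\beta_{\frac j2,\frac j2}}\right)\left(\prod_{j=2}^{N}\sqrt{\beta_{\frac{j+1}{2},\frac{j-1}{2}}}\right),$$ where all the variables on the right-hand side are independent beta variables with the indicated parameters.
   Context: For $a,b>0$, $\beta_{a,b}$ denotes a beta random variable with parameters $a,b$, i.e. with density $\frac{\Gamma(a+b)}{\Gamma(a)\Gamma(b)}x^{a-1}(1-x)^{b-1}$ on $(0,1)$. An empty product equals $1$. *)

theory Defs
  imports "HOL-Probability.Probability"
begin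

definition adjoint_mat :: "complex ^ 'n ^ 'n \<Rightarrow> complex ^ 'n ^ 'n" where
  "adjoint_mat A = map_matrix cnj (transpose A)"

text \<open>The group \<open>U(N)\<close>, where \<open>N = CARD('n)\<close>.\<close>

definition unitary_group :: "(complex ^ 'n ^ 'n) set" where
  "unitary_group = {A. A ** adjoint_mat A = mat 1 \<and> adjoint_mat A ** A = mat 1}"

text \<open>
  Haar probability measures on the compact group \<open>U(N)\<close>: Borel probability measures invariant under
  left translations. There is exactly one such measure (regularity is automatic, and so is right
  invariance, since the group is compact and metrizable), hence this predicate characterises the
  Haar probability measure.
\<close>

definition haar_prob_unitary :: "(complex ^ 'n ^ 'n) measure \<Rightarrow> bool" where
  "haar_prob_unitary H \<longleftrightarrow>
     prob_space H \<and>
     sets H = sets (restrict_space borel unitary_group) \<and>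
     (\<forall>U\<in>unitary_group. \<forall>E\<in>sets H. emeasure H ((\<lambda>A. U ** A) ` E) = emeasure H E)"

definition beta_density :: "real \<Rightarrow> real \<Rightarrow> real \<Rightarrow> real" where
  "beta_density a b x =
     (if 0 < x \<and> x < 1
      then Gamma (a + b) / (Gamma a * Gamma b) * x powr (a - 1) * (1 - x) powr (b - 1)
      else 0)"

end

theory Submission
  imports Defs
begin

text \<open>
  Both sides are bounded, so it suffices to compare the moments of their squares. If \<open>X\<close> is Haar
  distributed on \<open>U(m)\<close> and \<open>u\<close> is its column \<open>s\<close>, let \<open>R\<close> be the complex reflection taking the unit
  vector \<open>e\<close> of index \<open>s\<close> to \<open>u\<close>. Then \<open>X = R V\<close> with \<open>V\<close> fixing \<open>e\<close>, and column operations
  give \<open>det (I - X) = (1 - u\<^sub>s) det (I - V)\<close>, the last determinant being taken on \<open>m - 1\<close> coordinates.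
  Right invariance of \<open>X\<close> under the stabiliser of \<open>e\<close> makes \<open>V\<close> invariant and decouples the two
  factors. The moments of \<open>u\<^sub>s\<close> follow by comparing the coefficients of \<open>t\<close> in
  \<open>E |X\<^sub>s\<^sub>s + t X\<^sub>s\<^sub>j|^(2a) = (1 + t\<^sup>2)^a E |X\<^sub>s\<^sub>s|^(2a)\<close>, and Vandermonde's convolution gives those of
  \<open>|1 - u\<^sub>s|\<^sup>2\<close>. The duplication formula for \<open>pochhammer\<close> matches them with the beta moments.
\<close>

section \<open>Unitary matrices acting on a subset of the coordinates\<close>

lemma matrix_vector_mult_axis:
  fixes A :: "'a::comm_ring_1 ^ 'n ^ 'm"
  shows "A *v axis j 1 = column j A"
  by (simp add: matrix_vector_mult_def column_def axis_def vec_eq_iff if_distrib cong: if_cong)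

lemma adjoint_mat_nth [simp]: "adjoint_mat A $ i $ j = cnj (A $ j $ i)"
  by (simp add: adjoint_mat_def map_matrix_def transpose_def)

lemma adjoint_mat_adjoint_mat [simp]: "adjoint_mat (adjoint_mat A) = A"
  by (simp add: vec_eq_iff)

lemma adjoint_mat_mul: "adjoint_mat (A ** B) = adjoint_mat B ** adjoint_mat A"
  by (simp add: vec_eq_iff matrix_matrix_mult_def mult.commute)

lemma det_adjoint_mat:
  fixes A :: "complex ^ 'n ^ 'n"
  shows "det (adjoint_mat A) = cnj (det A)"
proof -
  have "det (map_matrix cnj A) = cnj (det A)" for A :: "complex ^ 'n ^ 'n"
    by (simp add: det_def map_matrix_def)
  then show ?thesis by (simp add: adjoint_mat_def)
qed

text \<open>For square matrices a right inverse is also a left inverse.\<close>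

lemma unitary_groupI: "A ** adjoint_mat A = mat 1 \<Longrightarrow> A \<in> unitary_group"
  using matrix_left_right_inverse[of A "adjoint_mat A"] by (simp add: unitary_group_def)

lemma unitary_group_adjoint: "A \<in> unitary_group \<Longrightarrow> adjoint_mat A \<in> unitary_group"
  by (simp add: unitary_group_def)

lemma unitary_group_mult:
  assumes "A \<in> unitary_group" "B \<in> unitary_group"
  shows "A ** B \<in> unitary_group"
proof (rule unitary_groupI)
  have "A ** B ** adjoint_mat (A ** B) = A ** (B ** adjoint_mat B) ** adjoint_mat A"
    by (simp add: adjoint_mat_mul matrix_mul_assoc)
  also have "\<dots> = mat 1"
    using assms by (simp add: unitary_group_def)
  finally show "A ** B ** adjoint_mat (A ** B) = mat 1" .
qed

lemma unitary_group_row_norm: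
  assumes "A \<in> unitary_group"
  shows "(\<Sum>j\<in>UNIV. (cmod (A $ i $ j))\<^sup>2) = 1"
proof -
  have "(A ** adjoint_mat A) $ i $ i = 1"
    using assms by (simp add: unitary_group_def mat_def)
  then have "complex_of_real (\<Sum>j\<in>UNIV. (cmod (A $ i $ j))\<^sup>2) = 1"
    unfolding of_real_sum complex_norm_square by (simp add: matrix_matrix_mult_def)
  then show ?thesis unfolding of_real_eq_1_iff .
qed

lemma unitary_group_entry_le:
  assumes "A \<in> unitary_group"
  shows "cmod (A $ i $ j) \<le> 1"
proof -
  have "(cmod (A $ i $ j))\<^sup>2 \<le> (\<Sum>j\<in>UNIV. (cmod (A $ i $ j))\<^sup>2)"
    by (rule member_le_sum) auto
  then have "(cmod (A $ i $ j))\<^sup>2 \<le> 1\<^sup>2" using unitary_group_row_norm[OF assms, of i] by simp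
  then show ?thesis by (rule power2_le_imp_le) simp
qed

section \<open>The unitary group of a coordinate subspace\<close>

text \<open>A copy of the unitary group of size \<open>card S\<close> inside the full one, as the
  pointwise stabiliser of the other axes. The induction on the dimension can thus run over subsets
  of one fixed index type.\<close>

definition unitary_on :: "'n set \<Rightarrow> (complex ^ 'n ^ 'n) set" where
  "unitary_on S = {A \<in> unitary_group. \<forall>j. j \<notin> S \<longrightarrow> A *v axis j 1 = axis j 1}"

lemma unitary_on_UNIV [simp]: "unitary_on UNIV = unitary_group"
  by (simp add: unitary_on_def)

lemma unitary_on_unitary: "A \<in> unitary_on S \<Longrightarrow> A \<in> unitary_group"
  by (simp add: unitary_on_def)

lemma unitary_on_mono: "S \<subseteq> T \<Longrightarrow> unitary_on S \<subseteq> unitary_on T"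
  by (auto simp: unitary_on_def)

lemma unitary_on_mult:
  "A \<in> unitary_on S \<Longrightarrow> B \<in> unitary_on S \<Longrightarrow> A ** B \<in> unitary_on S"
  by (auto simp: unitary_on_def unitary_group_mult simp flip: matrix_vector_mul_assoc)

lemma unitary_on_adjoint:
  assumes "A \<in> unitary_on S"
  shows "adjoint_mat A \<in> unitary_on S"
proof -
  have "adjoint_mat A *v axis j 1 = axis j 1" if "j \<notin> S" for j
  proof -
    have "adjoint_mat A *v axis j 1 = adjoint_mat A *v (A *v axis j 1)"
      using assms that by (simp add: unitary_on_def)
    also have "\<dots> = axis j 1"
      using assms by (simp add: matrix_vector_mul_assoc unitary_on_def unitary_group_def)
    finally show ?thesis .
  qed
  with assms show ?thesis by (simp add: unitary_on_def unitary_group_adjoint)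
qed

lemma unitary_on_column: "A \<in> unitary_on S \<Longrightarrow> j \<notin> S \<Longrightarrow> A $ i $ j = (if i = j then 1 else 0)"
  unfolding unitary_on_def matrix_vector_mult_axis by (auto simp: vec_eq_iff column_def axis_def)

text \<open>The adjoint fixes the same axes, and its columns are the conjugated rows of
  \<open>A\<close>.\<close>

lemma unitary_on_row:
  assumes "A \<in> unitary_on S" "i \<notin> S"
  shows "A $ i $ j = (if i = j then 1 else 0)"
proof -
  have "cnj (A $ i $ j) = (if i = j then 1 else 0)"
    using unitary_on_column[OF unitary_on_adjoint[OF assms(1)] assms(2), of j] by auto
  then have "cnj (cnj (A $ i $ j)) = cnj (if i = j then 1 else 0)" by simp
  then show ?thesis by (simp split: if_splits)
qed

text \<open>For \<open>A \<in> unitary_on S\<close> this is the determinant of \<open>I - A\<close> restricted to the coordinates in \<open>S\<close>: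
  the diagonal entry \<open>2\<close> turns the columns outside \<open>S\<close> into unit vectors.\<close>

definition det_on :: "'n set \<Rightarrow> complex ^ 'n ^ 'n \<Rightarrow> complex" where
  "det_on S A = det ((\<chi> i j. if i = j then if i \<in> S then 1 else 2 else 0) - A)"

lemma det_on_adjoint: "det_on S (adjoint_mat A) = cnj (det_on S A)"
proof -
  have "(\<chi> i j. if i = j then if i \<in> S then 1 else 2 else 0) - adjoint_mat A =
     adjoint_mat ((\<chi> i j. if i = j then if i \<in> S then 1 else 2 else 0) - A)"
    by (simp add: vec_eq_iff)
  then show ?thesis unfolding det_on_def by (simp add: det_adjoint_mat)
qed

section \<open>Complex reflections of the form I - c w w^H, with ^H for the conjugate
  transpose\<close>

definition rank_one_update :: "complex ^ 'n \<Rightarrow> complex \<Rightarrow> complex ^ 'n ^ 'n" where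
  "rank_one_update w c = (\<chi> i j. (if i = j then 1 else 0) - c * w $ i * cnj (w $ j))"

text \<open>The product w^H w is a scalar, so for fixed w these matrices multiply through their
  coefficients. Unitarity thereby becomes one equation in c.\<close>

lemma rank_one_update_mult:
  "rank_one_update w c ** rank_one_update w c' =
   rank_one_update w (c + c' - c * c' * (\<Sum>j\<in>UNIV. w $ j * cnj (w $ j)))"
proof -
  have "(rank_one_update w c ** rank_one_update w c') $ i $ k =
    (\<Sum>j\<in>UNIV. (if i = j then if j = k then 1 else 0 else 0) - (if i = j then c' * w $ j * cnj (w $ k) else 0)
      - (if j = k then c * w $ i * cnj (w $ j) else 0) + c * c' * w $ i * cnj (w $ k) * (w $ j * cnj (w $ j)))" for i k
    unfolding rank_one_update_def matrix_matrix_mult_def vec_lambda_beta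
    by (intro sum.cong refl) (auto simp: algebra_simps)
  then show ?thesis
    by (simp add: vec_eq_iff sum.distrib sum_subtractf sum_distrib_left[symmetric])
       (simp add: rank_one_update_def algebra_simps)
qed

lemma adjoint_rank_one_update: "adjoint_mat (rank_one_update w c) = rank_one_update w (cnj c)"
  by (auto simp: vec_eq_iff rank_one_update_def)

text \<open>The complex reflection taking \<open>axis s 1\<close> to the unit vector \<open>u\<close>. It is the identity if
  \<open>u = axis s 1\<close>, because then the scalar is \<open>1 / 0 = 0\<close>.\<close>

definition reflection :: "'n \<Rightarrow> complex ^ 'n \<Rightarrow> complex ^ 'n ^ 'n" where
  "reflection s u = rank_one_update (axis s 1 - u) (1 / (1 - cnj (u $ s)))"

context
  fixes s :: "'n::finite" and u :: "complex ^ 'n"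
  assumes u: "(\<Sum>j\<in>UNIV. u $ j * cnj (u $ j)) = 1"
begin

text \<open>For a unit vector this is 2 - 2 Re u_s, written as d + cnj d with d = 1 - u_s so that it
  cancels against 1 / d and 1 / cnj d.\<close>

lemma reflection_sum:
  "(\<Sum>j\<in>UNIV. (axis s 1 - u) $ j * cnj ((axis s 1 - u) $ j)) = (1 - u $ s) + (1 - cnj (u $ s))"
proof -
  have "(\<Sum>j\<in>UNIV. (axis s 1 - u) $ j * cnj ((axis s 1 - u) $ j)) =
    (\<Sum>j\<in>UNIV. (if j = s then 1 - u $ j - cnj (u $ j) else 0) + u $ j * cnj (u $ j))"
    by (intro sum.cong) (auto simp: axis_def algebra_simps)
  then show ?thesis by (simp add: sum.distrib u)
qed

lemma reflection_unitary: "reflection s u \<in> unitary_group"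
proof (rule unitary_groupI)
  let ?d = "1 - u $ s"
  \<comment> \<open>This is c + cnj c - |c|^2 |w|^2 = 0 for c = 1 / cnj d. If d = 0 it holds because
    \<open>1 / 0 = 0\<close>.\<close>
  have "1 / cnj ?d + 1 / ?d - 1 / cnj ?d * (1 / ?d) * (?d + cnj ?d) = 0"
    by (cases "?d = 0") (auto simp: field_simps)
  then show "reflection s u ** adjoint_mat (reflection s u) = mat 1"
    unfolding reflection_def adjoint_rank_one_update rank_one_update_mult reflection_sum
    by (simp add: rank_one_update_def mat_def)
qed

text \<open>In this case \<open>reflection_sum\<close> says that \<open>axis s 1 - u\<close> has
  norm zero.\<close>

lemma eq_axis_if_nth_eq_1:
  assumes "u $ s = 1"
  shows "u = axis s 1"
proof -
  have "complex_of_real (\<Sum>j\<in>UNIV. (cmod ((axis s 1 - u) $ j))\<^sup>2) = 0"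
    using reflection_sum assms by (simp only: of_real_sum complex_norm_square) simp
  then have "(\<Sum>j\<in>UNIV. (cmod ((axis s 1 - u) $ j))\<^sup>2) = 0" unfolding of_real_eq_0_iff .
  then show ?thesis by (subst (asm) sum_nonneg_eq_0_iff) (auto simp: vec_eq_iff)
qed

text \<open>For w = \<open>axis s 1 - u\<close> the scalar is the reciprocal of w^H applied to
  \<open>axis s 1\<close>, so the update subtracts exactly w from that axis.\<close>

lemma reflection_axis: "reflection s u *v axis s 1 = u"
proof (cases "u $ s = 1")
  case True
  then show ?thesis using eq_axis_if_nth_eq_1[OF True]
    unfolding matrix_vector_mult_axis
    by (auto simp: column_def vec_eq_iff reflection_def rank_one_update_def axis_def)
next
  case False
  then have "1 - cnj (u $ s) \<noteq> 0" by (metis complex_cnj_cnj complex_cnj_one eq_iff_diff_eq_0)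
  then show ?thesis
    unfolding matrix_vector_mult_axis
    by (auto simp: column_def vec_eq_iff reflection_def rank_one_update_def axis_def field_simps)
qed

end

section \<open>Splitting off one coordinate\<close>

text \<open>For unitary \<open>A\<close> this is the factor V in A = R V, where R is the reflection
  with the same column \<open>s\<close> as \<open>A\<close>.\<close>

definition reduce :: "'n \<Rightarrow> complex ^ 'n ^ 'n \<Rightarrow> complex ^ 'n ^ 'n" where
  "reduce s A = adjoint_mat (reflection s (column s A)) ** A"

lemma unitary_group_column_norm:
  assumes "A \<in> unitary_group"
  shows "(\<Sum>j\<in>UNIV. column s A $ j * cnj (column s A $ j)) = 1"
proof -
  have "(adjoint_mat A ** A) $ s $ s = 1"
    using assms by (simp add: unitary_group_def mat_def)
  then show ?thesis by (simp add: matrix_matrix_mult_def column_def mult.commute)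
qed

lemma reflection_mult_reduce:
  assumes "A \<in> unitary_group"
  shows "reflection s (column s A) ** reduce s A = A"
  using reflection_unitary[OF unitary_group_column_norm[OF assms], of s s]
  by (simp add: reduce_def matrix_mul_assoc unitary_group_def)

text \<open>The vector \<open>axis s 1 - u\<close> is supported in \<open>S\<close>, so the rank-one
  update does not touch the columns outside \<open>S\<close>.\<close>

lemma reflection_unitary_on:
  assumes u: "(\<Sum>j\<in>UNIV. u $ j * cnj (u $ j)) = 1"
    and S: "\<And>j. j \<notin> S \<Longrightarrow> u $ j = 0" and s: "s \<in> S"
  shows "reflection s u \<in> unitary_on S"
proof -
  have "reflection s u *v axis j 1 = axis j 1" if "j \<notin> S" for j
  proof -
    have "j \<noteq> s" "u $ j = 0" using that s S by auto
    then show ?thesis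
      unfolding matrix_vector_mult_axis
      by (auto simp: column_def vec_eq_iff reflection_def rank_one_update_def axis_def)
  qed
  then show ?thesis using reflection_unitary[OF u, of s] by (simp add: unitary_on_def)
qed

text \<open>\<open>A\<close> and its reflection send \<open>axis s 1\<close> to the same vector, so
  undoing the reflection after \<open>A\<close> fixes that axis. The reflection lies in
  \<open>unitary_on S\<close> because the rows of \<open>A\<close> outside \<open>S\<close> are unit
  vectors, which makes column \<open>s\<close> vanish there.\<close>

lemma reduce_unitary_on:
  assumes A: "A \<in> unitary_on S" and s: "s \<in> S"
  shows "reduce s A \<in> unitary_on (S - {s})"
proof -
  let ?R = "reflection s (column s A)"
  have R: "?R \<in> unitary_on S"
  proof (rule reflection_unitary_on[OF unitary_group_column_norm[OF unitary_on_unitary[OF A]] _ s])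
    show "column s A $ j = 0" if "j \<notin> S" for j
      using that s unitary_on_row[OF A, of j s] by (auto simp: column_def)
  qed
  have 1: "reduce s A \<in> unitary_on S" unfolding reduce_def
    by (intro unitary_on_mult unitary_on_adjoint R A)
  have "A *v axis s 1 = ?R *v axis s 1"
    unfolding reflection_axis[OF unitary_group_column_norm[OF unitary_on_unitary[OF A]]]
    by (rule matrix_vector_mult_axis)
  then have "reduce s A *v axis s 1 = adjoint_mat ?R *v (?R *v axis s 1)"
    by (simp add: reduce_def flip: matrix_vector_mul_assoc)
  also have "\<dots> = axis s 1"
    using unitary_on_unitary[OF R] by (simp add: matrix_vector_mul_assoc unitary_group_def)
  finally show ?thesis using 1 by (auto simp: unitary_on_def)
qed

text \<open>Since \<open>B\<close> fixes \<open>axis s 1\<close>, the product has the same column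
  \<open>s\<close> and hence the same reflection as \<open>A\<close>.\<close>

lemma reduce_mult:
  assumes "B \<in> unitary_on (S - {s})"
  shows "reduce s (A ** B) = reduce s A ** B"
proof -
  have "column s (A ** B) = column s A"
    using assms by (simp add: unitary_on_def matrix_vector_mult_axis[symmetric] flip: matrix_vector_mul_assoc)
  then show ?thesis by (simp add: reduce_def matrix_mul_assoc)
qed

text \<open>With \<open>w = axis s 1 - u\<close>, the matrix on the left arises from the one on the right by replacing
  the unit column \<open>s\<close> by \<open>w\<close> and then adding multiples of \<open>w\<close> to the other columns.\<close>

lemma det_on_reduce:
  fixes A :: "complex ^ 'n ^ 'n"
  assumes A: "A \<in> unitary_on S" and s: "s \<in> S"
  shows "det_on S A = (1 - A $ s $ s) * det_on (S - {s}) (reduce s A)"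
proof -
  define u where "u = column s A"
  define w where "w = axis s 1 - u"
  define V where "V = reduce s A"
  define d where "d = 1 / (1 - cnj (u $ s))"
  define E :: "'n set \<Rightarrow> complex ^ 'n ^ 'n"
    where "E T = (\<chi> i j. if i = j then if i \<in> T then 1 else 2 else 0)" for T
  define X where "X = E (S - {s}) - V"
  \<comment> \<open>As A = V - d w (w^H V), column j of \<open>E S - A\<close> is column j of X plus
    c_j w when j differs from s. Column s is w itself, whence the value 1 there.\<close>
  define c where "c = (\<chi> j. if j = s then 1 else
    d * (\<Sum>k\<in>UNIV. cnj (w $ k) * V $ k $ j))"
  \<comment> \<open>L is the identity with column s replaced by w, and C the identity with row s
    replaced by c.\<close>
  define L where "L = (\<chi> i j. if j = s then w $ i else (mat 1 :: complex ^ 'n ^ 'n) $ i $ j)"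
  define C where "C = transpose (\<chi> i j. if j = s then c $ i else (mat 1 :: complex ^ 'n ^ 'n) $ i $ j)"
  have V: "V \<in> unitary_on (S - {s})" unfolding V_def by (rule reduce_unitary_on[OF A s])
  have Vcol: "V $ i $ s = (if i = s then 1 else 0)" for i
    using unitary_on_column[OF V, of s i] by auto
  have Vrow: "V $ s $ i = (if i = s then 1 else 0)" for i
    using unitary_on_row[OF V, of s i] by auto
  have AV: "A = reflection s u ** V"
    unfolding u_def V_def by (rule reflection_mult_reduce[OF unitary_on_unitary[OF A], symmetric])
  have Aij: "A $ i $ j = V $ i $ j - d * w $ i * (\<Sum>k\<in>UNIV. cnj (w $ k) * V $ k $ j)" for i j
  proof -
    have "A $ i $ j = (\<Sum>k\<in>UNIV. (if i = k then V $ k $ j else 0)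
        - d * w $ i * (cnj (w $ k) * V $ k $ j))"
      unfolding AV by (auto simp: matrix_matrix_mult_def reflection_def rank_one_update_def
        algebra_simps simp flip: w_def d_def intro!: sum.cong)
    also have "\<dots> = V $ i $ j - d * w $ i * (\<Sum>k\<in>UNIV. cnj (w $ k) * V $ k $ j)"
      by (simp add: sum_subtractf sum_distrib_left)
    finally show ?thesis .
  qed
  \<comment> \<open>The diagonal entry at s is 2 - 1, because s has left the set.\<close>
  have Xcol: "X $ i $ s = (if i = s then 1 else 0)" for i by (simp add: X_def E_def Vcol)
  have Xrow: "X $ s $ i = (if i = s then 1 else 0)" for i by (auto simp add: X_def E_def Vrow)
  have LX: "(L ** X) $ i $ j = (if j = s then w $ i else X $ i $ j)" for i j
  proof -
    have "(L ** X) $ i $ j = (\<Sum>k\<in>UNIV. (if k = s then w $ i * X $ s $ j else 0) +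
       (if k = i then (if i = s then 0 else X $ i $ j) else 0))"
      unfolding L_def matrix_matrix_mult_def vec_lambda_beta mat_def by (intro sum.cong refl) auto
    also have "\<dots> = w $ i * X $ s $ j + (if i = s then 0 else X $ i $ j)" by (simp add: sum.distrib)
    also have "\<dots> = (if j = s then w $ i else X $ i $ j)" by (auto simp: Xrow Xcol)
    finally show ?thesis .
  qed
  have "E S - A = L ** X ** C"
  proof -
    have "(L ** X ** C) $ i $ j = (E S - A) $ i $ j" for i j
    proof -
      have "(L ** X ** C) $ i $ j = (\<Sum>k\<in>UNIV. (if k = s then w $ i * c $ j else 0) +
         (if k = j then (if j = s then 0 else X $ i $ j) else 0))"
        unfolding matrix_matrix_mult_def[of "L ** X"] vec_lambda_beta LX
        unfolding C_def transpose_def mat_def vec_lambda_beta by (intro sum.cong refl) auto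
      also have "\<dots> = w $ i * c $ j + (if j = s then 0 else X $ i $ j)" by (simp add: sum.distrib)
      also have "\<dots> = (E S - A) $ i $ j"
      proof (cases "j = s")
        case True
        then show ?thesis using s by (auto simp: c_def w_def u_def axis_def column_def E_def)
      next
        case False
        then show ?thesis using s
          by (auto simp: X_def E_def c_def Aij[of i j])
      qed
      finally show ?thesis .
    qed
    then show ?thesis by (simp add: vec_eq_iff)
  qed
  \<comment> \<open>Cramer's rule for the identity matrix: replacing one column by a vector leaves
    the corresponding entry of the vector as determinant.\<close>
  moreover have "det L = 1 - A $ s $ s"
    using cramer_lemma[of s "mat 1" w] unfolding L_def matrix_vector_mul_lid by (simp add: w_def u_def column_def)
  moreover have "det C = 1"
    using cramer_lemma[of s "mat 1" c] unfolding C_def matrix_vector_mul_lid det_transpose by (simp add: c_def)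
  moreover have "det_on S A = det (E S - A)" "det_on (S - {s}) V = det X"
    by (simp_all add: det_on_def E_def X_def)
  ultimately show ?thesis by (simp add: det_mul V_def)
qed

section \<open>Right-invariant random matrices\<close>

lemma borel_measurable_vec_nth [measurable]:
  fixes f :: "'a \<Rightarrow> 'b::euclidean_space ^ 'n"
  assumes "f \<in> borel_measurable M"
  shows "(\<lambda>x. f x $ i) \<in> borel_measurable M"
  using assms by (rule borel_measurable_continuous_on[rotated]) (intro continuous_intros)

lemma borel_measurable_vec_lambda:
  fixes f :: "'a \<Rightarrow> 'n::finite \<Rightarrow> 'b::euclidean_space"
  assumes "\<And>i. (\<lambda>x. f x i) \<in> borel_measurable M"
  shows "(\<lambda>x. \<chi> i. f x i) \<in> borel_measurable M"
  unfolding borel_measurable_euclidean_space[of "\<lambda>x. \<chi> i. f x i"]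
  using assms by (auto simp: Basis_vec_def inner_axis borel_measurable_inner)

lemma borel_measurable_matrix_mult [measurable]:
  fixes f g :: "'a \<Rightarrow> complex ^ 'n ^ 'n"
  assumes [measurable]: "f \<in> borel_measurable M" "g \<in> borel_measurable M"
  shows "(\<lambda>x. f x ** g x) \<in> borel_measurable M"
  unfolding matrix_matrix_mult_def by (intro borel_measurable_vec_lambda) measurable

lemma borel_measurable_cnj [measurable]: "cnj \<in> borel_measurable borel"
  by (intro borel_measurable_continuous_onI continuous_intros)

lemma borel_measurable_adjoint_mat [measurable]:
  "(adjoint_mat :: complex ^ 'n ^ 'n \<Rightarrow> _) \<in> borel_measurable borel"
  unfolding adjoint_mat_def map_matrix_def transpose_def vec_lambda_beta
  by (intro borel_measurable_vec_lambda) measurable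

lemma borel_measurable_det [measurable]:
  fixes f :: "'a \<Rightarrow> complex ^ 'n ^ 'n"
  assumes [measurable]: "f \<in> borel_measurable M"
  shows "(\<lambda>x. det (f x)) \<in> borel_measurable M"
  unfolding det_def by measurable

lemma borel_measurable_det_on [measurable]:
  "(det_on S :: complex ^ 'n ^ 'n \<Rightarrow> _) \<in> borel_measurable borel"
  unfolding det_on_def by measurable

lemma borel_measurable_reduce [measurable]:
  "(reduce s :: complex ^ 'n ^ 'n \<Rightarrow> _) \<in> borel_measurable borel"
proof -
  have "(\<lambda>A. reflection s (column s A) :: complex ^ 'n ^ 'n) \<in> borel_measurable borel"
    unfolding reflection_def rank_one_update_def column_def vector_minus_component vec_lambda_beta
    by (intro borel_measurable_vec_lambda) measurable
  then show ?thesis unfolding reduce_def by measurable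
qed

section \<open>Right invariance and the decoupling of the two factors\<close>

text \<open>On a probability space this says that X is Haar distributed on the copy
  \<open>unitary_on S\<close>. Stating it by invariance avoids constructing a Haar measure on every
  such subgroup.\<close>

definition right_invariant :: "'a measure \<Rightarrow> ('a \<Rightarrow> complex ^ 'n ^ 'n) \<Rightarrow> 'n set \<Rightarrow> bool" where
  "right_invariant M X S \<longleftrightarrow> X \<in> borel_measurable M \<and> (\<forall>\<omega>\<in>space M. X \<omega> \<in> unitary_on S) \<and>
     (\<forall>U\<in>unitary_on S. distr M borel (\<lambda>\<omega>. X \<omega> ** U) = distr M borel X)"

lemma right_invariantD:
  assumes "right_invariant M X S"
  shows "X \<in> borel_measurable M" "\<omega> \<in> space M \<Longrightarrow> X \<omega> \<in> unitary_on S"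
    "U \<in> unitary_on S \<Longrightarrow> distr M borel (\<lambda>\<omega>. X \<omega> ** U) = distr M borel X"
  using assms by (auto simp: right_invariant_def)

lemma right_invariant_nn_integral:
  fixes X :: "'a \<Rightarrow> complex ^ 'n ^ 'n"
  assumes X: "right_invariant M X S" and U: "U \<in> unitary_on S" and [measurable]: "f \<in> borel_measurable borel"
  shows "(\<integral>\<^sup>+\<omega>. f (X \<omega> ** U) \<partial>M) = (\<integral>\<^sup>+\<omega>. f (X \<omega>) \<partial>M)"
proof -
  note [measurable] = right_invariantD(1)[OF X]
  have "(\<integral>\<^sup>+\<omega>. f (X \<omega> ** U) \<partial>M) = (\<integral>\<^sup>+A. f A \<partial>distr M borel (\<lambda>\<omega>. X \<omega> ** U))"
    by (simp add: nn_integral_distr)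
  also have "\<dots> = (\<integral>\<^sup>+\<omega>. f (X \<omega>) \<partial>M)"
    unfolding right_invariantD(3)[OF X U] by (simp add: nn_integral_distr)
  finally show ?thesis .
qed

lemma right_invariant_integral:
  fixes X :: "'a \<Rightarrow> complex ^ 'n ^ 'n" and f :: "_ \<Rightarrow> 'b :: {banach, second_countable_topology}"
  assumes X: "right_invariant M X S" and U: "U \<in> unitary_on S" and [measurable]: "f \<in> borel_measurable borel"
  shows "(\<integral>\<omega>. f (X \<omega> ** U) \<partial>M) = (\<integral>\<omega>. f (X \<omega>) \<partial>M)"
proof -
  note [measurable] = right_invariantD(1)[OF X]
  have "(\<integral>\<omega>. f (X \<omega> ** U) \<partial>M) = (\<integral>A. f A \<partial>distr M borel (\<lambda>\<omega>. X \<omega> ** U))"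
    by (simp add: integral_distr)
  also have "\<dots> = (\<integral>\<omega>. f (X \<omega>) \<partial>M)"
    unfolding right_invariantD(3)[OF X U] by (simp add: integral_distr)
  finally show ?thesis .
qed

text \<open>By \<open>reduce_mult\<close>, the reduced matrix times U is the reduction of X U, which
  has the law of the reduction of X.\<close>

lemma right_invariant_reduce:
  assumes X: "right_invariant M X S" and s: "s \<in> S"
  shows "right_invariant M (\<lambda>\<omega>. reduce s (X \<omega>)) (S - {s})"
  unfolding right_invariant_def
proof (intro conjI ballI)
  note [measurable] = right_invariantD(1)[OF X]
  show "(\<lambda>\<omega>. reduce s (X \<omega>)) \<in> borel_measurable M" by measurable
  show "reduce s (X \<omega>) \<in> unitary_on (S - {s})" if "\<omega> \<in> space M" for \<omega>
    by (intro reduce_unitary_on s right_invariantD(2)[OF X that])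
  fix U :: "complex ^ 'b ^ 'b" assume U: "U \<in> unitary_on (S - {s})"
  then have U': "U \<in> unitary_on S" using unitary_on_mono[of "S - {s}" S] by blast
  have "distr M borel (\<lambda>\<omega>. reduce s (X \<omega>) ** U) = distr (distr M borel (\<lambda>\<omega>. X \<omega> ** U)) borel (reduce s)"
    by (subst distr_distr) (auto simp: comp_def reduce_mult[OF U])
  also have "\<dots> = distr M borel (\<lambda>\<omega>. reduce s (X \<omega>))"
    unfolding right_invariantD(3)[OF X U'] by (subst distr_distr) (auto simp: comp_def)
  finally show "distr M borel (\<lambda>\<omega>. reduce s (X \<omega>) ** U) = distr M borel (\<lambda>\<omega>. reduce s (X \<omega>))" .
qed

text \<open>X is multiplied by the adjoint of an independent copy of its own reduced part V, which
  keeps the law and the column s. Averaging over the copy first, by Fubini, makes the reduced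
  determinant contribute a constant.\<close>

lemma nn_integral_det_on_reduce:
  fixes X :: "'a \<Rightarrow> complex ^ 'n ^ 'n"
  assumes M: "prob_space M" and X: "right_invariant M X S" and s: "s \<in> S"
  shows "(\<integral>\<^sup>+\<omega>. ennreal (cmod (det_on S (X \<omega>)) ^ k) \<partial>M) =
    (\<integral>\<^sup>+\<omega>. ennreal (cmod (1 - X \<omega> $ s $ s) ^ k) \<partial>M) *
    (\<integral>\<^sup>+\<omega>. ennreal (cmod (det_on (S - {s}) (reduce s (X \<omega>))) ^ k) \<partial>M)"
proof -
  interpret M: prob_space M by (rule M)
  interpret MM: pair_prob_space M M ..
  note [measurable] = right_invariantD(1)[OF X]
  define V where "V \<omega> = reduce s (X \<omega>)" for \<omega>
  define D where "D A = ennreal (cmod (det_on (S - {s}) A) ^ k)" for A :: "complex ^ 'n ^ 'n"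
  define F where "F \<omega> = ennreal (cmod (1 - X \<omega> $ s $ s) ^ k)" for \<omega>
  have [measurable]: "V \<in> borel_measurable M" "F \<in> borel_measurable M" "D \<in> borel_measurable borel"
    unfolding V_def D_def F_def by measurable
  have V: "right_invariant M V (S - {s})" unfolding V_def by (rule right_invariant_reduce[OF X s])
  \<comment> \<open>For fixed \<omega>' the adjoint of \<open>V \<omega>'\<close> is a deterministic
    matrix fixing \<open>axis s 1\<close>, so right invariance of X applies to it.\<close>
  have 1: "(\<integral>\<^sup>+\<omega>. ennreal (cmod (det_on S (X \<omega>)) ^ k) \<partial>M) =
      (\<integral>\<^sup>+\<omega>. F \<omega> * D (V \<omega> ** adjoint_mat (V \<omega>')) \<partial>M)" if \<omega>': "\<omega>' \<in> space M" for \<omega>'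
  proof -
    let ?U = "adjoint_mat (V \<omega>')"
    have U: "?U \<in> unitary_on (S - {s})" by (intro unitary_on_adjoint right_invariantD(2)[OF V \<omega>'])
    then have U': "?U \<in> unitary_on S" using unitary_on_mono[of "S - {s}" S] by blast
    have "(\<integral>\<^sup>+\<omega>. ennreal (cmod (det_on S (X \<omega>)) ^ k) \<partial>M) = (\<integral>\<^sup>+\<omega>. ennreal (cmod (det_on S (X \<omega> ** ?U)) ^ k) \<partial>M)"
      by (rule right_invariant_nn_integral[OF X U', symmetric]) measurable
    also have "\<dots> = (\<integral>\<^sup>+\<omega>. F \<omega> * D (V \<omega> ** ?U) \<partial>M)"
    proof (intro nn_integral_cong)
      fix \<omega> assume "\<omega> \<in> space M"
      then have XU: "X \<omega> ** ?U \<in> unitary_on S" using right_invariantD(2)[OF X] U' by (intro unitary_on_mult)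
      have "column s (X \<omega> ** ?U) = column s (X \<omega>)"
        using U by (simp add: unitary_on_def matrix_vector_mult_axis[symmetric] flip: matrix_vector_mul_assoc)
      then have "(X \<omega> ** ?U) $ s $ s = X \<omega> $ s $ s" by (simp add: column_def vec_eq_iff)
      then show "ennreal (cmod (det_on S (X \<omega> ** ?U)) ^ k) = F \<omega> * D (V \<omega> ** ?U)"
        unfolding det_on_reduce[OF XU s] reduce_mult[OF U]
        by (simp add: F_def D_def V_def norm_mult power_mult_distrib ennreal_mult)
    qed
    finally show ?thesis .
  qed
  have "(\<integral>\<^sup>+\<omega>. ennreal (cmod (det_on S (X \<omega>)) ^ k) \<partial>M) =
      (\<integral>\<^sup>+\<omega>'. \<integral>\<^sup>+\<omega>. ennreal (cmod (det_on S (X \<omega>)) ^ k) \<partial>M \<partial>M)"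
    by (simp add: M.emeasure_space_1)
  also have "\<dots> = (\<integral>\<^sup>+\<omega>'. \<integral>\<^sup>+\<omega>. F \<omega> * D (V \<omega> ** adjoint_mat (V \<omega>')) \<partial>M \<partial>M)"
    by (intro nn_integral_cong 1)
  also have "\<dots> = (\<integral>\<^sup>+\<omega>. \<integral>\<^sup>+\<omega>'. F \<omega> * D (V \<omega> ** adjoint_mat (V \<omega>')) \<partial>M \<partial>M)"
    by (rule MM.Fubini') measurable
  also have "\<dots> = (\<integral>\<^sup>+\<omega>. F \<omega> * (\<integral>\<^sup>+\<omega>'. D (V \<omega>') \<partial>M) \<partial>M)"
  proof (intro nn_integral_cong)
    fix \<omega> assume \<omega>: "\<omega> \<in> space M"
    have "(\<integral>\<^sup>+\<omega>'. F \<omega> * D (V \<omega> ** adjoint_mat (V \<omega>')) \<partial>M) = F \<omega> * (\<integral>\<^sup>+\<omega>'. D (V \<omega> ** adjoint_mat (V \<omega>')) \<partial>M)"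
      by (rule nn_integral_cmult) measurable
    \<comment> \<open>V is invariant on the right only, so the fixed matrix has to change sides.
      Taking the adjoint does this and merely conjugates the determinant.\<close>
    also have "(\<integral>\<^sup>+\<omega>'. D (V \<omega> ** adjoint_mat (V \<omega>')) \<partial>M) = (\<integral>\<^sup>+\<omega>'. D (V \<omega>' ** adjoint_mat (V \<omega>)) \<partial>M)"
    proof (intro nn_integral_cong)
      fix \<omega>'
      have "V \<omega> ** adjoint_mat (V \<omega>') = adjoint_mat (V \<omega>' ** adjoint_mat (V \<omega>))"
        by (simp add: adjoint_mat_mul)
      then show "D (V \<omega> ** adjoint_mat (V \<omega>')) = D (V \<omega>' ** adjoint_mat (V \<omega>))"
        by (simp only: D_def det_on_adjoint complex_mod_cnj)
    qed
    also have "\<dots> = (\<integral>\<^sup>+\<omega>'. D (V \<omega>') \<partial>M)"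
      by (intro right_invariant_nn_integral[OF V] unitary_on_adjoint right_invariantD(2)[OF V \<omega>]) measurable
    finally show "(\<integral>\<^sup>+\<omega>'. F \<omega> * D (V \<omega> ** adjoint_mat (V \<omega>')) \<partial>M) = F \<omega> * (\<integral>\<^sup>+\<omega>'. D (V \<omega>') \<partial>M)" .
  qed
  also have "\<dots> = (\<integral>\<^sup>+\<omega>. F \<omega> \<partial>M) * (\<integral>\<^sup>+\<omega>'. D (V \<omega>') \<partial>M)"
    by (rule nn_integral_multc) measurable
  finally show ?thesis by (simp add: F_def D_def V_def)
qed

text \<open>Haar measure is given as left invariant. The adjoint turns this into right invariance,
  and it only conjugates the determinant of I - \<Lambda>.\<close>

lemma haar_right_invariant_adjoint:
  fixes H :: "(complex ^ 'n ^ 'n) measure"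
  assumes H: "haar_prob_unitary H" and \<Lambda>: "\<Lambda> \<in> \<Omega> \<rightarrow>\<^sub>M H" "distr \<Omega> H \<Lambda> = H"
  shows "right_invariant \<Omega> (\<lambda>\<omega>. adjoint_mat (\<Lambda> \<omega>)) UNIV"
proof -
  have sets: "sets H = sets (restrict_space borel unitary_group)" using H by (simp add: haar_prob_unitary_def)
  then have space: "space H = unitary_group" by (auto dest: sets_eq_imp_space_eq simp: space_restrict_space)
  have borelH: "f \<in> borel \<rightarrow>\<^sub>M borel \<Longrightarrow> f \<in> H \<rightarrow>\<^sub>M borel" for f :: "complex ^ 'n ^ 'n \<Rightarrow> complex ^ 'n ^ 'n"
    unfolding measurable_cong_sets[OF sets refl] by (rule measurable_restrict_space1)
  have [measurable]: "adjoint_mat \<in> H \<rightarrow>\<^sub>M (borel :: (complex ^ 'n ^ 'n) measure)" by (rule borelH) measurable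
  note [measurable] = \<Lambda>(1)
  have inv: "distr H H (\<lambda>A. W ** A) = H" if W: "W \<in> unitary_group" for W
  proof (rule measure_eqI)
    have meas: "(\<lambda>A. W ** A) \<in> H \<rightarrow>\<^sub>M H"
      unfolding measurable_cong_sets[OF refl sets]
      by (rule measurable_restrict_space2) (auto simp: space unitary_group_mult[OF W] intro!: borelH)
    fix E assume "E \<in> sets (distr H H (\<lambda>A. W ** A))"
    then have E: "E \<in> sets H" by simp
    have cancel: "adjoint_mat W ** (W ** A) = A" "W ** (adjoint_mat W ** A) = A" for A
      using W by (simp_all add: matrix_mul_assoc unitary_group_def)
    \<comment> \<open>The definition speaks of images, a distribution of preimages: the preimage
      under W is the image under its inverse, the adjoint.\<close>
    have "(\<lambda>A. W ** A) -` E \<inter> space H = (\<lambda>A. adjoint_mat W ** A) ` E"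
    proof (intro equalityI subsetI)
      fix A assume "A \<in> (\<lambda>A. adjoint_mat W ** A) ` E"
      then obtain C where C: "C \<in> E" "A = adjoint_mat W ** C" by blast
      then have "C \<in> unitary_group" using sets.sets_into_space[OF E] space by auto
      with C W show "A \<in> (\<lambda>A. W ** A) -` E \<inter> space H"
        by (simp add: cancel space unitary_group_mult unitary_group_adjoint)
    next
      fix A assume "A \<in> (\<lambda>A. W ** A) -` E \<inter> space H"
      then show "A \<in> (\<lambda>A. adjoint_mat W ** A) ` E" by (intro image_eqI[of _ _ "W ** A"]) (simp_all add: cancel)
    qed
    then show "emeasure (distr H H (\<lambda>A. W ** A)) E = emeasure H E"
      using H E unitary_group_adjoint[OF W] by (simp add: emeasure_distr[OF meas E] haar_prob_unitary_def)
  qed simp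
  show ?thesis unfolding right_invariant_def unitary_on_UNIV
  proof (intro conjI ballI)
    show "(\<lambda>\<omega>. adjoint_mat (\<Lambda> \<omega>)) \<in> borel_measurable \<Omega>" by measurable
    show "adjoint_mat (\<Lambda> \<omega>) \<in> unitary_group" if "\<omega> \<in> space \<Omega>" for \<omega>
      using measurable_space[OF \<Lambda>(1) that] by (simp add: space unitary_group_adjoint)
    fix U :: "complex ^ 'n ^ 'n" assume "U \<in> unitary_group"
    then have W: "adjoint_mat U \<in> unitary_group" by (rule unitary_group_adjoint)
    have meas[measurable]: "(\<lambda>A. adjoint_mat U ** A) \<in> H \<rightarrow>\<^sub>M H"
      unfolding measurable_cong_sets[OF refl sets]
      by (rule measurable_restrict_space2) (auto simp: space unitary_group_mult[OF W] intro!: borelH)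
    have "distr \<Omega> borel (\<lambda>\<omega>. adjoint_mat (\<Lambda> \<omega>) ** U) = distr (distr (distr \<Omega> H \<Lambda>) H (\<lambda>A. adjoint_mat U ** A)) borel adjoint_mat"
      by (simp add: distr_distr comp_def adjoint_mat_mul)
    also have "\<dots> = distr (distr \<Omega> H \<Lambda>) borel adjoint_mat" unfolding \<Lambda>(2) inv[OF W] ..
    also have "\<dots> = distr \<Omega> borel (\<lambda>\<omega>. adjoint_mat (\<Lambda> \<omega>))" by (simp add: distr_distr comp_def)
    finally show "distr \<Omega> borel (\<lambda>\<omega>. adjoint_mat (\<Lambda> \<omega>) ** U) = distr \<Omega> borel (\<lambda>\<omega>. adjoint_mat (\<Lambda> \<omega>))" .
  qed
qed

section \<open>Moments of matrix entries and of the determinant\<close>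

lemma right_invariant_integrable_entries:
  assumes M: "prob_space M" and X: "right_invariant M X S"
  shows "integrable M (\<lambda>\<omega>. X \<omega> $ i $ j ^ a * cnj (X \<omega> $ i $ j) ^ b * (X \<omega> $ i $ k ^ c * cnj (X \<omega> $ i $ k) ^ d))"
proof -
  interpret prob_space M by (rule M)
  note [measurable] = right_invariantD(1)[OF X]
  show ?thesis
  proof (rule integrable_const_bound[where B = 1])
    have "cmod (X \<omega> $ i $ j) ^ n \<le> 1" if "\<omega> \<in> space M" for \<omega> n j
      using unitary_group_entry_le[OF unitary_on_unitary[OF right_invariantD(2)[OF X that]]]
      by (intro power_le_one) auto
    then show "AE \<omega> in M. cmod (X \<omega> $ i $ j ^ a * cnj (X \<omega> $ i $ j) ^ b * (X \<omega> $ i $ k ^ c * cnj (X \<omega> $ i $ k) ^ d)) \<le> 1"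
      by (intro AE_I2) (auto simp: norm_mult norm_power intro!: mult_le_one)
  qed measurable
qed

definition phase_matrix :: "'n \<Rightarrow> complex \<Rightarrow> complex ^ 'n ^ 'n" where
  "phase_matrix s z = (\<chi> i j. if i = j then if i = s then z else 1 else 0)"

lemma phase_matrix_unitary_on:
  assumes "z * cnj z = 1" "s \<in> S"
  shows "phase_matrix s z \<in> unitary_on S"
proof -
  have "(phase_matrix s z ** adjoint_mat (phase_matrix s z)) $ i $ j = (mat 1 :: complex ^ 'a ^ 'a) $ i $ j" for i j
  proof -
    have "(phase_matrix s z ** adjoint_mat (phase_matrix s z)) $ i $ j =
        (\<Sum>k\<in>UNIV. if k = i then if i = j then 1 else 0 else 0)"
      unfolding matrix_matrix_mult_def vec_lambda_beta
      by (intro sum.cong) (auto simp: phase_matrix_def assms(1))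
    then show ?thesis by (simp add: mat_def)
  qed
  then have "phase_matrix s z \<in> unitary_group" by (intro unitary_groupI) (simp add: vec_eq_iff)
  moreover have "phase_matrix s z *v axis j 1 = axis j 1" if "j \<notin> S" for j
    unfolding matrix_vector_mult_axis using assms(2) that
    by (auto simp: column_def vec_eq_iff axis_def phase_matrix_def)
  ultimately show ?thesis by (simp add: unitary_on_def)
qed

lemma mult_phase_matrix: "(A ** phase_matrix s z) $ i $ j = (if j = s then z * A $ i $ j else A $ i $ j)"
proof -
  have "(A ** phase_matrix s z) $ i $ j = (\<Sum>k\<in>UNIV. if k = j then if j = s then z * A $ i $ j else A $ i $ j else 0)"
    unfolding matrix_matrix_mult_def vec_lambda_beta by (intro sum.cong) (auto simp: phase_matrix_def)
  then show ?thesis by simp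
qed

text \<open>Multiplying column s by a phase z keeps the law and multiplies f by z^p cnj z^q. A phase
  for which this factor is -1 makes the integral its own negative.\<close>

lemma right_invariant_integral_phase_eq_0:
  fixes f :: "complex ^ 'n ^ 'n \<Rightarrow> complex"
  assumes X: "right_invariant M X S" and s: "s \<in> S" and [measurable]: "f \<in> borel_measurable borel"
    and f: "\<And>A z. z * cnj z = 1 \<Longrightarrow> f (A ** phase_matrix s z) = z ^ p * cnj z ^ q * f A" and pq: "p \<noteq> q"
  shows "(\<integral>\<omega>. f (X \<omega>) \<partial>M) = 0"
proof -
  \<comment> \<open>Chosen so that (p - q) \<theta> = pi.\<close>
  define \<theta> where "\<theta> = pi / (real p - real q)"
  define z where "z = cis \<theta>"
  have z: "z * cnj z = 1" by (simp add: z_def cis_cnj cis_mult)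
  have "z ^ p * cnj z ^ q = cis (real p * \<theta> - real q * \<theta>)"
    by (simp add: z_def cis_cnj Complex.DeMoivre cis_mult)
  also have "real p * \<theta> - real q * \<theta> = pi"
    using pq unfolding \<theta>_def left_diff_distrib[symmetric] by simp
  finally have "z ^ p * cnj z ^ q = -1" by simp
  then have "f (X \<omega> ** phase_matrix s z) = - f (X \<omega>)" for \<omega> using f[OF z, of "X \<omega>"] by simp
  then have "(\<integral>\<omega>. f (X \<omega>) \<partial>M) = - (\<integral>\<omega>. f (X \<omega>) \<partial>M)"
    using right_invariant_integral[OF X phase_matrix_unitary_on[OF z s], of f] by simp
  then show ?thesis by simp
qed

text \<open>Right multiplication by a unitary matrix with column s equal to (e_s + t e_j) / r, where
  r normalises, turns entry (s,s) into the combination on the left divided by r.\<close>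

lemma right_invariant_entry_rotation:
  fixes X :: "'a \<Rightarrow> complex ^ 'n ^ 'n" and t :: real
  assumes X: "right_invariant M X S" and s: "s \<in> S" and j: "j \<in> S" "j \<noteq> s"
  shows "(\<integral>\<omega>. (cmod (X \<omega> $ s $ s + t * X \<omega> $ s $ j))\<^sup>2 ^ a \<partial>M) =
    (1 + t\<^sup>2) ^ a * (\<integral>\<omega>. (cmod (X \<omega> $ s $ s))\<^sup>2 ^ a \<partial>M)"
proof -
  define r where "r = sqrt (1 + t\<^sup>2)"
  have r: "r\<^sup>2 = 1 + t\<^sup>2" "r > 0" by (auto simp: r_def add_pos_nonneg)
  define u :: "complex ^ 'n" where "u = (\<chi> i. if i = s then 1 / r else if i = j then t / r else 0)"
  have "(\<Sum>i\<in>UNIV. u $ i * cnj (u $ i)) =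
      (\<Sum>i\<in>UNIV. (if i = s then complex_of_real (1 / r\<^sup>2) else 0) + (if i = j then complex_of_real (t\<^sup>2 / r\<^sup>2) else 0))"
    using j by (intro sum.cong) (auto simp: u_def power2_eq_square)
  also have "\<dots> = complex_of_real (1 / r\<^sup>2 + t\<^sup>2 / r\<^sup>2)" by (simp add: sum.distrib)
  also have "1 / r\<^sup>2 + t\<^sup>2 / r\<^sup>2 = 1" unfolding r(1) using add_pos_nonneg[of 1 "t\<^sup>2"] by (simp flip: add_divide_distrib)
  finally have u1: "(\<Sum>i\<in>UNIV. u $ i * cnj (u $ i)) = 1" by simp
  \<comment> \<open>Only column s of U matters; the reflection completes u to a unitary
    matrix.\<close>
  define U where "U = reflection s u"
  have U: "U \<in> unitary_on S" unfolding U_def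
    by (rule reflection_unitary_on[OF u1 _ s]) (use s j in \<open>auto simp: u_def\<close>)
  have XU: "(A ** U) $ s $ s = (A $ s $ s + t * A $ s $ j) / r" for A :: "complex ^ 'n ^ 'n"
  proof -
    have "column s (A ** U) = A *v (U *v axis s 1)"
      by (simp add: matrix_vector_mult_axis[symmetric] flip: matrix_vector_mul_assoc)
    also have "\<dots> = A *v u" by (simp add: U_def reflection_axis[OF u1])
    finally have "(A ** U) $ s $ s = (A *v u) $ s" by (simp add: column_def vec_eq_iff)
    also have "\<dots> = (\<Sum>i\<in>UNIV. (if i = s then A $ s $ s / r else 0) + (if i = j then t * A $ s $ j / r else 0))"
      unfolding matrix_vector_mult_def vec_lambda_beta using j by (intro sum.cong) (auto simp: u_def)
    finally show ?thesis by (simp add: sum.distrib add_divide_distrib)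
  qed
  have "(\<integral>\<omega>. (cmod (X \<omega> $ s $ s))\<^sup>2 ^ a \<partial>M) = (\<integral>\<omega>. (cmod ((X \<omega> ** U) $ s $ s))\<^sup>2 ^ a \<partial>M)"
    by (rule right_invariant_integral[OF X U, symmetric]) measurable
  also have "\<dots> = (\<integral>\<omega>. (1 / (1 + t\<^sup>2) ^ a) * (cmod (X \<omega> $ s $ s + t * X \<omega> $ s $ j))\<^sup>2 ^ a \<partial>M)"
    unfolding XU using r by (simp add: norm_divide power_divide)
  also have "\<dots> = 1 / (1 + t\<^sup>2) ^ a * (\<integral>\<omega>. (cmod (X \<omega> $ s $ s + t * X \<omega> $ s $ j))\<^sup>2 ^ a \<partial>M)"
    by (rule integral_mult_right_zero)
  finally show ?thesis using add_pos_nonneg[of 1 "t\<^sup>2"] by (simp add: field_simps)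
qed

text \<open>Both sides of \<open>right_invariant_entry_rotation\<close> are polynomials in t^2 once
  the unbalanced terms have vanished. The coefficients of t^(2p) are binom(a,p)^2 times the mixed
  moment and binom(a,p) times the pure one.\<close>

lemma right_invariant_mixed_moment:
  fixes X :: "'a \<Rightarrow> complex ^ 'n ^ 'n"
  assumes M: "prob_space M" and X: "right_invariant M X S" and s: "s \<in> S" and j: "j \<in> S" "j \<noteq> s"
    and p: "p \<le> a"
  shows "real (a choose p) * (\<integral>\<omega>. (cmod (X \<omega> $ s $ s))\<^sup>2 ^ (a - p) * (cmod (X \<omega> $ s $ j))\<^sup>2 ^ p \<partial>M) =
    (\<integral>\<omega>. (cmod (X \<omega> $ s $ s))\<^sup>2 ^ a \<partial>M)"
proof -
  interpret prob_space M by (rule M)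
  note [measurable] = right_invariantD(1)[OF X]
  define c where "c = (\<integral>\<omega>. (cmod (X \<omega> $ s $ s))\<^sup>2 ^ a \<partial>M)"
  define m where "m p = (\<integral>\<omega>. (cmod (X \<omega> $ s $ s))\<^sup>2 ^ (a - p) * (cmod (X \<omega> $ s $ j))\<^sup>2 ^ p \<partial>M)" for p
  define g where "g p q A = (A $ s $ s) ^ (a - p) * cnj (A $ s $ s) ^ (a - q) *
    ((A $ s $ j) ^ p * cnj (A $ s $ j) ^ q)" for p q and A :: "complex ^ 'n ^ 'n"
  have [measurable]: "g p q \<in> borel_measurable borel" for p q unfolding g_def by measurable
  have g_int: "integrable M (\<lambda>\<omega>. g p q (X \<omega>))" for p q
    unfolding g_def by (rule right_invariant_integrable_entries[OF M X])
  have g0: "(\<integral>\<omega>. g p q (X \<omega>) \<partial>M) = (if p = q then complex_of_real (m p) else 0)" for p q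
  proof (cases "p = q")
    case True
    have "g p p A = complex_of_real ((cmod (A $ s $ s))\<^sup>2 ^ (a - p) * (cmod (A $ s $ j))\<^sup>2 ^ p)" for A
      unfolding g_def of_real_mult of_real_power[of _ p] of_real_power[of _ "a - p"] complex_norm_square
      by (simp add: power_mult_distrib)
    then show ?thesis using True by (simp add: m_def del: of_real_mult of_real_power)
  next
    case False
    \<comment> \<open>A phase in column j leaves entry (s,s) alone and multiplies
      \<open>g p q\<close> by z^p cnj z^q.\<close>
    have "(\<integral>\<omega>. g p q (X \<omega>) \<partial>M) = 0"
      by (rule right_invariant_integral_phase_eq_0[OF X j(1) _ _ False])
         (use j in \<open>simp_all add: g_def mult_phase_matrix power_mult_distrib\<close>)
    with False show ?thesis by simp
  qed
  have expand: "complex_of_real ((cmod (x + t * y))\<^sup>2 ^ a) =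
     (\<Sum>p\<le>a. \<Sum>q\<le>a. of_nat (a choose p) * of_nat (a choose q) * complex_of_real t ^ (p + q) *
        (x ^ (a - p) * cnj x ^ (a - q) * (y ^ p * cnj y ^ q)))" for x y :: complex and t :: real
  proof -
    have "complex_of_real ((cmod (x + t * y))\<^sup>2 ^ a) = (t * y + x) ^ a * (t * cnj y + cnj x) ^ a"
      unfolding of_real_power[of _ a] complex_norm_square by (simp add: power_mult_distrib add.commute)
    then show ?thesis unfolding binomial_ring sum_product
      by (simp add: power_mult_distrib power_add mult_ac)
  qed
  have poly: "(\<Sum>i\<le>a. (real (a choose i) * real (a choose i) * m i - c * real (a choose i)) * x ^ i) = 0" if "x \<ge> 0" for x
  proof -
    define t where "t = sqrt x"
    have t: "t\<^sup>2 = x" using that by (simp add: t_def)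
    have "complex_of_real ((1 + t\<^sup>2) ^ a * c) = complex_of_real (\<integral>\<omega>. (cmod (X \<omega> $ s $ s + t * X \<omega> $ s $ j))\<^sup>2 ^ a \<partial>M)"
      by (simp only: right_invariant_entry_rotation[OF X s j] c_def)
    also have "\<dots> = (\<integral>\<omega>. complex_of_real ((cmod (X \<omega> $ s $ s + t * X \<omega> $ s $ j))\<^sup>2 ^ a) \<partial>M)"
      by (rule integral_complex_of_real[symmetric])
    also have "\<dots> = (\<integral>\<omega>. (\<Sum>p\<le>a. \<Sum>q\<le>a. of_nat (a choose p) * of_nat (a choose q) * complex_of_real t ^ (p + q) * g p q (X \<omega>)) \<partial>M)"
      unfolding expand g_def ..
    also have "\<dots> = (\<Sum>p\<le>a. \<Sum>q\<le>a. of_nat (a choose p) * of_nat (a choose q) * complex_of_real t ^ (p + q) * (\<integral>\<omega>. g p q (X \<omega>) \<partial>M))"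
      by (simp add: g_int)
    also have "\<dots> = (\<Sum>p\<le>a. complex_of_real (real (a choose p) * real (a choose p) * x ^ p * m p))"
      unfolding g0 by (intro sum.cong refl) (simp add: if_distrib t[symmetric] power_mult[symmetric] mult_2[symmetric] cong: if_cong)
    also have "\<dots> = complex_of_real (\<Sum>p\<le>a. real (a choose p) * real (a choose p) * x ^ p * m p)" by simp
    finally have "(1 + t\<^sup>2) ^ a * c = (\<Sum>p\<le>a. real (a choose p) * real (a choose p) * x ^ p * m p)"
      unfolding of_real_eq_iff .
    moreover have "(1 + t\<^sup>2) ^ a = (\<Sum>p\<le>a. real (a choose p) * x ^ p)"
      unfolding t using binomial_ring[of x 1 a] by (simp add: add.commute)
    ultimately show ?thesis
      by (simp add: sum_distrib_left sum_subtractf algebra_simps)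
  qed
  \<comment> \<open>The identity is known for x = t^2, so for x \<ge> 0 only. These are infinitely
    many roots, which forces every coefficient to vanish.\<close>
  have "\<not> finite {x. (\<Sum>i\<le>a. (real (a choose i) * real (a choose i) * m i - c * real (a choose i)) * x ^ i) = 0}"
    using poly by (intro infinite_super[OF _ infinite_Ici[of "0::real"]]) auto
  then have "real (a choose p) * real (a choose p) * m p - c * real (a choose p) = 0"
    using p unfolding polyfun_finite_roots by auto
  moreover have "real (a choose p) \<noteq> 0" using p by simp
  ultimately have "real (a choose p) * m p = c" by (simp add: algebra_simps)
  then show ?thesis by (simp add: m_def c_def)
qed

text \<open>Row s has norm 1, so inserting its squared norm into the moment of order a gives a sum
  of moments of total order a + 1. The mixed ones among them are known, which leaves a recursion in
  a.\<close>

lemma right_invariant_entry_moment: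
  fixes X :: "'a \<Rightarrow> complex ^ 'n ^ 'n"
  assumes M: "prob_space M" and X: "right_invariant M X S" and s: "s \<in> S"
  shows "(\<integral>\<omega>. (cmod (X \<omega> $ s $ s))\<^sup>2 ^ a \<partial>M) = fact a * fact (card S - 1) / fact (card S + a - 1)"
proof (induction a)
  case 0
  interpret prob_space M by (rule M)
  show ?case by (simp add: prob_space)
next
  case (Suc a)
  interpret prob_space M by (rule M)
  note [measurable] = right_invariantD(1)[OF X]
  define c where "c a = (\<integral>\<omega>. (cmod (X \<omega> $ s $ s))\<^sup>2 ^ a \<partial>M)" for a
  obtain m where m: "card S = Suc m" using s by (metis card_Suc_Diff1 finite)
  have int: "integrable M (\<lambda>\<omega>. (cmod (X \<omega> $ s $ s))\<^sup>2 ^ a * (cmod (X \<omega> $ s $ j))\<^sup>2)" for j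
  proof (rule integrable_const_bound[where B = 1])
    have "cmod (X \<omega> $ i $ j) \<le> 1" if "\<omega> \<in> space M" for \<omega> i j
      by (rule unitary_group_entry_le[OF unitary_on_unitary[OF right_invariantD(2)[OF X that]]])
    then show "AE \<omega> in M. norm ((cmod (X \<omega> $ s $ s))\<^sup>2 ^ a * (cmod (X \<omega> $ s $ j))\<^sup>2) \<le> 1"
      by (intro AE_I2) (auto simp: intro!: mult_le_one power_le_one)
  qed measurable
  have "c a = (\<integral>\<omega>. (\<Sum>j\<in>S. (cmod (X \<omega> $ s $ s))\<^sup>2 ^ a * (cmod (X \<omega> $ s $ j))\<^sup>2) \<partial>M)"
    unfolding c_def
  proof (intro Bochner_Integration.integral_cong refl)
    fix \<omega> assume "\<omega> \<in> space M"
    then have "X \<omega> \<in> unitary_on S" by (rule right_invariantD(2)[OF X])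
    have "(\<Sum>j\<in>S. (cmod (X \<omega> $ s $ j))\<^sup>2) = (\<Sum>j\<in>UNIV. (cmod (X \<omega> $ s $ j))\<^sup>2)"
      by (rule sum.mono_neutral_left) (use unitary_on_column[OF \<open>X \<omega> \<in> unitary_on S\<close>, of _ s] s in auto)
    also have "\<dots> = 1" by (rule unitary_group_row_norm[OF unitary_on_unitary[OF \<open>X \<omega> \<in> unitary_on S\<close>]])
    finally show "(cmod (X \<omega> $ s $ s))\<^sup>2 ^ a = (\<Sum>j\<in>S. (cmod (X \<omega> $ s $ s))\<^sup>2 ^ a * (cmod (X \<omega> $ s $ j))\<^sup>2)"
      by (simp flip: sum_distrib_left)
  qed
  also have "\<dots> = (\<Sum>j\<in>S. \<integral>\<omega>. (cmod (X \<omega> $ s $ s))\<^sup>2 ^ a * (cmod (X \<omega> $ s $ j))\<^sup>2 \<partial>M)"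
    by (rule Bochner_Integration.integral_sum) (rule int)
  also have "\<dots> = c (Suc a) + (\<Sum>j\<in>S - {s}. \<integral>\<omega>. (cmod (X \<omega> $ s $ s))\<^sup>2 ^ a * (cmod (X \<omega> $ s $ j))\<^sup>2 \<partial>M)"
    using s by (subst sum.remove[of S s]) (auto simp: c_def mult_ac)
  \<comment> \<open>The mixed moments with p = 1, where the binomial coefficient is a + 1.\<close>
  also have "(\<Sum>j\<in>S - {s}. \<integral>\<omega>. (cmod (X \<omega> $ s $ s))\<^sup>2 ^ a * (cmod (X \<omega> $ s $ j))\<^sup>2 \<partial>M) =
      (\<Sum>j\<in>S - {s}. c (Suc a) / (a + 1))"
    by (intro sum.cong refl)
       (use right_invariant_mixed_moment[OF M X s, of _ 1 "Suc a"] in \<open>auto simp: c_def field_simps\<close>)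
  also have "\<dots> = (card S - 1) * c (Suc a) / (a + 1)" using s by (simp add: card_Diff_singleton)
  finally have *: "c a * (a + 1) = c (Suc a) * (card S + a)"
    by (simp add: m field_simps)
  have "c (Suc a) = c a * (a + 1) / (card S + a)" using * m by (simp add: field_simps)
  also have "c a = fact a * fact (card S - 1) / fact (card S + a - 1)" using Suc by (simp add: c_def)
  also have "fact a * fact (card S - 1) / fact (card S + a - 1) * (a + 1) / (card S + a) =
      fact (Suc a) * fact (card S - 1) / (fact (card S + Suc a - 1) :: real)"
    by (simp add: m field_simps)
  finally show ?case by (simp add: c_def)
qed

section \<open>Moments of the determinant\<close>

text \<open>Up to a factor free of p, each summand is binom(k,p) binom(m+k,k-p), and Vandermonde's
  convolution applies.\<close>

lemma binomial_square_sum: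
  "(\<Sum>p\<le>k. real (k choose p) * real (k choose p) * (fact p * fact m / fact (m + p))) =
    fact m * fact (m + 2 * k) / (fact (m + k))\<^sup>2"
proof -
  have "real (k choose p) * real (k choose p) * (fact p * fact m / fact (m + p)) =
     fact k * fact m / fact (m + k) * real ((k choose p) * ((m + k) choose (k - p)))" if "p \<le> k" for p
  proof -
    have 1: "real (k choose p) = fact k / (fact p * fact (k - p))" by (rule binomial_fact[OF that])
    have 2: "real ((m + k) choose (k - p)) = fact (m + k) / (fact (k - p) * fact (m + p))"
      using binomial_fact[of "k - p" "m + k", where 'a = real] that by simp
    show ?thesis unfolding of_nat_mult 1 2 by (simp add: field_simps)
  qed
  then have "(\<Sum>p\<le>k. real (k choose p) * real (k choose p) * (fact p * fact m / fact (m + p))) =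
     (\<Sum>p\<le>k. fact k * fact m / fact (m + k) * real ((k choose p) * ((m + k) choose (k - p))))"
    by (intro sum.cong) auto
  also have "\<dots> = fact k * fact m / fact (m + k) * real ((k + (m + k)) choose k)"
    by (simp only: vandermonde flip: sum_distrib_left of_nat_sum)
  also have "real ((k + (m + k)) choose k) = fact (m + 2 * k) / (fact k * fact (m + k))"
    by (subst binomial_fact) (simp_all add: mult_2 add_ac)
  finally show ?thesis by (simp add: field_simps power2_eq_square)
qed

text \<open>In the expansion of |1 - x|^(2k) a phase in column s removes all terms with unequal
  powers of x and cnj x. The signs of the others are positive, leaving squared binomials times the
  moments of |x|^2.\<close>

lemma right_invariant_one_minus_entry_moment:
  fixes X :: "'a \<Rightarrow> complex ^ 'n ^ 'n"
  assumes M: "prob_space M" and X: "right_invariant M X S" and s: "s \<in> S"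
  shows "(\<integral>\<^sup>+\<omega>. ennreal (cmod (1 - X \<omega> $ s $ s) ^ (2 * k)) \<partial>M) =
    ennreal (fact (card S - 1) * fact (card S - 1 + 2 * k) / (fact (card S - 1 + k))\<^sup>2)"
proof -
  interpret prob_space M by (rule M)
  note [measurable] = right_invariantD(1)[OF X]
  define c where "c p = (\<integral>\<omega>. (cmod (X \<omega> $ s $ s))\<^sup>2 ^ p \<partial>M)" for p
  define g where "g p q A = (A $ s $ s) ^ p * cnj (A $ s $ s) ^ q" for p q and A :: "complex ^ 'n ^ 'n"
  have [measurable]: "g p q \<in> borel_measurable borel" for p q unfolding g_def by measurable
  have g_int: "integrable M (\<lambda>\<omega>. g p q (X \<omega>))" for p q
    using right_invariant_integrable_entries[OF M X, of s s p q s 0 0] by (simp add: g_def)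
  have g0: "(\<integral>\<omega>. g p q (X \<omega>) \<partial>M) = (if p = q then complex_of_real (c p) else 0)" for p q
  proof (cases "p = q")
    case True
    have "g p p A = complex_of_real ((cmod (A $ s $ s))\<^sup>2 ^ p)" for A
      unfolding g_def of_real_power[of _ p] complex_norm_square by (simp add: power_mult_distrib)
    then show ?thesis using True by (simp add: c_def del: of_real_power)
  next
    case False
    have "(\<integral>\<omega>. g p q (X \<omega>) \<partial>M) = 0"
      by (rule right_invariant_integral_phase_eq_0[OF X s _ _ False])
         (simp_all add: g_def mult_phase_matrix power_mult_distrib)
    with False show ?thesis by simp
  qed
  have expand: "complex_of_real (cmod (1 - x) ^ (2 * k)) =
     (\<Sum>p\<le>k. \<Sum>q\<le>k. of_nat (k choose p) * of_nat (k choose q) * (- 1) ^ (p + q) * (x ^ p * cnj x ^ q))" for x :: complex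
  proof -
    have "complex_of_real (cmod (1 - x) ^ (2 * k)) = (- x + 1) ^ k * (- cnj x + 1) ^ k"
      unfolding power_mult of_real_power[of _ k] complex_norm_square by (simp add: power_mult_distrib)
    then show ?thesis unfolding binomial_ring sum_product
      by (simp add: power_minus[of x] power_minus[of "cnj x"] power_add mult_ac)
  qed
  have int: "integrable M (\<lambda>\<omega>. complex_of_real (cmod (1 - X \<omega> $ s $ s) ^ (2 * k)))"
    unfolding expand using g_int unfolding g_def by (intro Bochner_Integration.integrable_sum integrable_mult_right)
  have "complex_of_real (\<integral>\<omega>. cmod (1 - X \<omega> $ s $ s) ^ (2 * k) \<partial>M) = (\<integral>\<omega>. complex_of_real (cmod (1 - X \<omega> $ s $ s) ^ (2 * k)) \<partial>M)"
    by (rule integral_complex_of_real[symmetric])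
  also have "\<dots> = (\<integral>\<omega>. (\<Sum>p\<le>k. \<Sum>q\<le>k. of_nat (k choose p) * of_nat (k choose q) * (- 1) ^ (p + q) * g p q (X \<omega>)) \<partial>M)"
    unfolding expand g_def ..
  also have "\<dots> = (\<Sum>p\<le>k. \<Sum>q\<le>k. of_nat (k choose p) * of_nat (k choose q) * (- 1) ^ (p + q) * (\<integral>\<omega>. g p q (X \<omega>) \<partial>M))"
    by (simp add: g_int)
  also have "\<dots> = complex_of_real (\<Sum>p\<le>k. real (k choose p) * real (k choose p) * c p)"
    unfolding g0 of_real_sum by (intro sum.cong refl) (simp add: if_distrib cong: if_cong)
  finally have "(\<integral>\<omega>. cmod (1 - X \<omega> $ s $ s) ^ (2 * k) \<partial>M) = (\<Sum>p\<le>k. real (k choose p) * real (k choose p) * c p)"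
    unfolding of_real_eq_iff .
  also have "\<dots> = (\<Sum>p\<le>k. real (k choose p) * real (k choose p) * (fact p * fact (card S - 1) / fact (card S - 1 + p)))"
  proof -
    obtain m where m: "card S = Suc m" using s by (metis card_Suc_Diff1 finite)
    show ?thesis by (simp add: c_def right_invariant_entry_moment[OF M X s] m)
  qed
  finally have *: "(\<integral>\<omega>. cmod (1 - X \<omega> $ s $ s) ^ (2 * k) \<partial>M) =
    fact (card S - 1) * fact (card S - 1 + 2 * k) / (fact (card S - 1 + k))\<^sup>2"
    unfolding binomial_square_sum .
  have "integrable M (\<lambda>\<omega>. cmod (1 - X \<omega> $ s $ s) ^ (2 * k))"
    using integrable_Re[OF int] by (simp only: Re_complex_of_real)
  then have "(\<integral>\<^sup>+\<omega>. ennreal (cmod (1 - X \<omega> $ s $ s) ^ (2 * k)) \<partial>M) = ennreal (\<integral>\<omega>. cmod (1 - X \<omega> $ s $ s) ^ (2 * k) \<partial>M)"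
    by (intro nn_integral_eq_integral) auto
  with * show ?thesis by simp
qed

text \<open>Induction on S, with X arbitrary because the hypothesis passes to the reduced matrix.
  Removing s from \<open>insert s S\<close> contributes the factor with j =
  \<open>card S\<close>.\<close>

lemma right_invariant_det_moment:
  fixes X :: "'a \<Rightarrow> complex ^ 'n ^ 'n"
  assumes M: "prob_space M" and X: "right_invariant M X S"
  shows "(\<integral>\<^sup>+\<omega>. ennreal (cmod (det_on S (X \<omega>)) ^ (2 * k)) \<partial>M) =
    ennreal (\<Prod>j<card S. fact j * fact (j + 2 * k) / (fact (j + k))\<^sup>2)"
  using finite[of S] X
proof (induction S arbitrary: X rule: finite_induct)
  case empty
  interpret prob_space M by (rule M)
  have "det_on {} (X \<omega>) = 1" if "\<omega> \<in> space M" for \<omega>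
  proof -
    \<comment> \<open>With no coordinates left, X is the identity and the matrix is 2 I - I.\<close>
    have "(\<chi> i j. if i = j then if i \<in> {} then 1 else 2 else 0) - X \<omega> = mat 1"
      using unitary_on_column[OF right_invariantD(2)[OF empty that]] by (simp add: vec_eq_iff mat_def)
    then show ?thesis by (simp add: det_on_def)
  qed
  then have "(\<integral>\<^sup>+\<omega>. ennreal (cmod (det_on {} (X \<omega>)) ^ (2 * k)) \<partial>M) = (\<integral>\<^sup>+\<omega>. 1 \<partial>M)"
    by (intro nn_integral_cong) simp
  then show ?case by (simp add: emeasure_space_1)
next
  case (insert s S)
  have "insert s S - {s} = S" using insert by auto
  then have "right_invariant M (\<lambda>\<omega>. reduce s (X \<omega>)) S"
    using right_invariant_reduce[OF insert.prems, of s] by simp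
  from insert.IH[OF this] \<open>insert s S - {s} = S\<close> insert.hyps show ?case
    unfolding nn_integral_det_on_reduce[OF M insert.prems insertI1]
      right_invariant_one_minus_entry_moment[OF M insert.prems insertI1]
    by (simp add: ennreal_mult[symmetric] prod_nonneg mult.commute)
qed

section \<open>The moment problem and beta variables\<close>

text \<open>The bound c^k makes the Taylor expansion of the characteristic function converge
  everywhere, so the moments determine it, and Levy's uniqueness theorem recovers the law.\<close>

lemma distr_eq_if_moments_eq:
  fixes X :: "'a \<Rightarrow> real" and Y :: "'b \<Rightarrow> real"
  assumes M: "prob_space M" and N: "prob_space N"
    and [measurable]: "X \<in> borel_measurable M" "Y \<in> borel_measurable N"
    and pos: "AE x in M. 0 \<le> X x" "AE x in N. 0 \<le> Y x"
    and X: "\<And>k. (\<integral>\<^sup>+x. ennreal (X x ^ k) \<partial>M) = ennreal (m k)"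
    and Y: "\<And>k. (\<integral>\<^sup>+x. ennreal (Y x ^ k) \<partial>N) = ennreal (m k)"
    and m: "\<And>k. 0 \<le> m k" "\<And>k. m k \<le> c ^ k"
  shows "distr M borel X = distr N borel Y"
proof -
  \<comment> \<open>The Taylor polynomial depends on the moments only, so the same one approximates
    both characteristic functions.\<close>
  have approx: "cmod (char (distr P borel Z) t - (\<Sum>k\<le>n. ((\<i> * t) ^ k / fact k) * m k)) \<le> 2 * ((\<bar>t\<bar> * c) ^ n / fact n)"
    if P: "prob_space P" and [measurable]: "Z \<in> borel_measurable P" and pos: "AE x in P. 0 \<le> Z x"
      and Z: "\<And>k. (\<integral>\<^sup>+x. ennreal (Z x ^ k) \<partial>P) = ennreal (m k)"
    for P :: "'z measure" and Z t n
  proof -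
    interpret prob_space P by (rule P)
    have Zpos: "AE x in P. 0 \<le> Z x ^ k" for k using pos by eventually_elim simp
    have int: "integrable P (\<lambda>x. Z x ^ k)" for k
      by (rule integrableI_nonneg[OF _ Zpos]) (simp_all add: Z)
    have EZ: "expectation (\<lambda>x. Z x ^ k) = m k" for k
      using m by (subst integral_eq_nn_integral[OF _ Zpos]) (simp_all add: Z)
    \<comment> \<open>The remainder estimate involves absolute moments, which equal the plain ones
      by positivity.\<close>
    have "expectation (\<lambda>x. \<bar>Z x\<bar> ^ n) = expectation (\<lambda>x. Z x ^ n)"
      by (rule integral_cong_AE) (use pos in \<open>auto\<close>)
    then have EZabs: "expectation (\<lambda>x. \<bar>Z x\<bar> ^ n) = m n" by (simp add: EZ)
    have "cmod (char (distr P borel Z) t - (\<Sum>k\<le>n. ((\<i> * t) ^ k / fact k) * m k)) \<le> (2 * \<bar>t\<bar> ^ n / fact n) * m n"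
      using char_approx1'[of n Z "distr P borel Z" t] int by (simp add: EZ EZabs)
    also have "\<dots> \<le> (2 * \<bar>t\<bar> ^ n / fact n) * c ^ n" by (intro mult_left_mono m) auto
    finally show ?thesis by (simp add: power_mult_distrib)
  qed
  have "char (distr M borel X) t = char (distr N borel Y) t" for t
  proof -
    let ?S = "\<lambda>n. (\<Sum>k\<le>n. ((\<i> * t) ^ k / fact k) * m k)"
    let ?e = "\<lambda>n. 2 * ((\<bar>t\<bar> * c) ^ n / fact n)"
    have "cmod (char (distr M borel X) t - char (distr N borel Y) t) \<le> ?e n + ?e n" for n
      using norm_triangle_ineq4[of "char (distr M borel X) t - ?S n" "char (distr N borel Y) t - ?S n"]
        approx[OF M _ pos(1) X, of t n] approx[OF N _ pos(2) Y, of t n] by simp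
    moreover have "(\<lambda>n. ?e n + ?e n) \<longlonglongrightarrow> 2 * 0 + 2 * 0"
      using summable_LIMSEQ_zero[OF summable_exp[of "\<bar>t\<bar> * c"]]
      by (intro tendsto_intros) (simp_all add: field_simps)
    ultimately have "cmod (char (distr M borel X) t - char (distr N borel Y) t) \<le> 2 * 0 + 2 * 0"
      by (intro LIMSEQ_le_const) auto
    then show ?thesis by simp
  qed
  then show ?thesis
    by (intro Levy_uniqueness prob_space.real_distribution_distr M N) auto
qed

section \<open>Moments of beta variables\<close>

text \<open>The k-th power shifts the first parameter, so the moment is a ratio of Beta integrals,
  whose Gamma quotients are Pochhammer symbols.\<close>

lemma nn_integral_beta_moment:
  assumes X: "distributed M lborel X (\<lambda>x. ennreal (beta_density a b x))" and a: "a > 0" and b: "b > 0"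
  shows "(\<integral>\<^sup>+\<omega>. ennreal (X \<omega> ^ k) \<partial>M) = ennreal (pochhammer a k / pochhammer (a + b) k)"
proof -
  let ?c = "Gamma (a + b) / (Gamma a * Gamma b)"
  have c: "?c \<ge> 0" using a b by (simp add: Gamma_real_pos less_imp_le)
  have "(\<integral>\<^sup>+\<omega>. ennreal (X \<omega> ^ k) \<partial>M) = (\<integral>\<^sup>+x. ennreal (beta_density a b x) * ennreal (x ^ k) \<partial>lborel)"
    by (rule distributed_nn_integral[OF X, symmetric]) measurable
  also have "\<dots> = (\<integral>\<^sup>+x. ennreal (indicator {0..1} x * (?c * (x powr (a + k - 1) * (1 - x) powr (b - 1)))) \<partial>lborel)"
  proof (intro nn_integral_cong)
    fix x :: real
    show "ennreal (beta_density a b x) * ennreal (x ^ k) = ennreal (indicator {0..1} x * (?c * (x powr (a + k - 1) * (1 - x) powr (b - 1))))"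
    proof (cases "0 < x \<and> x < 1")
      case True
      then have "x powr (a + k - 1) = x powr (a - 1) * x ^ k"
        by (simp add: powr_add[symmetric] powr_realpow[symmetric] algebra_simps)
      with True c show ?thesis
        by (simp add: beta_density_def flip: ennreal_mult'') (simp add: mult_ac)
    next
      case False
      \<comment> \<open>The Beta integral runs over the closed interval; at its endpoints the
        integrand is zero like the density, because \<open>0 powr y = 0\<close>.\<close>
      then have "x = 0 \<or> x = 1 \<or> x \<notin> {0..1}" by auto
      then show ?thesis by (auto simp: beta_density_def)
    qed
  qed
  also have "\<dots> = ennreal (?c * Beta (a + k) b)"
  proof (rule nn_integral_has_integral_lebesgue)
    show "((\<lambda>x. ?c * (x powr (a + real k - 1) * (1 - x) powr (b - 1))) has_integral ?c * Beta (a + real k) b) {0..1}"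
      using a b by (intro has_integral_mult_right has_integral_Beta_real) auto
  qed (intro mult_nonneg_nonneg c powr_ge_zero)
  also have "?c * Beta (a + k) b = pochhammer a k / pochhammer (a + b) k"
  proof -
    have "Gamma a > 0" "Gamma b > 0" "Gamma (a + b) > 0" using a b by (auto intro: Gamma_real_pos)
    moreover have "a \<notin> \<int>\<^sub>\<le>\<^sub>0" "a + b \<notin> \<int>\<^sub>\<le>\<^sub>0" using a b by (auto elim!: nonpos_Ints_cases)
    ultimately show ?thesis by (simp add: pochhammer_Gamma Beta_def add_ac)
  qed
  finally show ?thesis .
qed

lemma AE_beta:
  assumes "distributed M lborel X (\<lambda>x. ennreal (beta_density a b x))"
  shows "AE \<omega> in M. 0 \<le> X \<omega> \<and> X \<omega> \<le> 1"
proof -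
  have "AE x in density lborel (\<lambda>x. ennreal (beta_density a b x)). 0 \<le> x \<and> x \<le> 1"
    using distributed_borel_measurable[OF assms] by (auto simp: AE_density beta_density_def)
  then have "AE x in distr M lborel X. 0 \<le> x \<and> x \<le> 1"
    unfolding distributed_distr_eq_density[OF assms] .
  then show ?thesis by (rule AE_distrD[OF distributed_measurable[OF assms]])
qed

text \<open>Matches the moments of the beta product with those of the determinant, one dimension at
  a time.\<close>

lemma prod_pochhammer_halves:
  "4 ^ (N * k) * ((\<Prod>j=1..N. pochhammer (real j / 2) k / pochhammer (real j) k) *
     (\<Prod>j=2..N. pochhammer ((real j + 1) / 2) k / pochhammer (real j) k)) =
   (\<Prod>j<N. fact j * fact (j + 2 * k) / (fact (j + k))\<^sup>2)"
proof (induction N)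
  case (Suc N)
  define z where "z = real (Suc N)"
  have poch: "pochhammer z n = fact (N + n) / fact N" for n
    unfolding pochhammer_fact[of "N + n"] pochhammer_fact[of N] pochhammer_product'[of 1 N n]
    using pochhammer_pos[of "1::real" N] by (simp add: z_def)
  have z: "4 ^ k * (pochhammer (z / 2) k / pochhammer z k * (pochhammer ((z + 1) / 2) k / pochhammer z k)) =
     fact N * fact (N + 2 * k) / (fact (N + k))\<^sup>2"
  proof -
    \<comment> \<open>The duplication formula merges the two half-integer symbols.\<close>
    have "4 ^ k * (pochhammer (z / 2) k * pochhammer ((z + 1) / 2) k) = pochhammer z (2 * k)"
      using pochhammer_double[of "z / 2" k] by (simp add: add_divide_distrib power_mult)
    then have "4 ^ k * (pochhammer (z / 2) k / pochhammer z k * (pochhammer ((z + 1) / 2) k / pochhammer z k)) =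
      pochhammer z (2 * k) / (pochhammer z k)\<^sup>2" by (simp add: power2_eq_square)
    then show ?thesis unfolding poch by (simp add: field_simps power2_eq_square)
  qed
  have "(\<Prod>j=2..Suc N. pochhammer ((real j + 1) / 2) k / pochhammer (real j) k) =
    (\<Prod>j=2..N. pochhammer ((real j + 1) / 2) k / pochhammer (real j) k) * (pochhammer ((z + 1) / 2) k / pochhammer z k)"
  proof (cases N)
    \<comment> \<open>The second product starts at 2. The factor split off for z = 1 is
      \<open>pochhammer 1 k / pochhammer 1 k\<close>, hence 1.\<close>
    case 0
    then show ?thesis using pochhammer_pos[of "1::real" k] by (simp add: z_def)
  qed (simp add: z_def)
  then have "4 ^ (Suc N * k) * ((\<Prod>j=1..Suc N. pochhammer (real j / 2) k / pochhammer (real j) k) *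
      (\<Prod>j=2..Suc N. pochhammer ((real j + 1) / 2) k / pochhammer (real j) k)) =
    (4 ^ (N * k) * ((\<Prod>j=1..N. pochhammer (real j / 2) k / pochhammer (real j) k) *
      (\<Prod>j=2..N. pochhammer ((real j + 1) / 2) k / pochhammer (real j) k))) *
    (4 ^ k * (pochhammer (z / 2) k / pochhammer z k * (pochhammer ((z + 1) / 2) k / pochhammer z k)))"
    by (simp add: z_def power_add mult_ac)
  then show ?case unfolding Suc.IH z by simp
qed simp

section \<open>Comparison of the two laws\<close>

theorem theorem2p1:
  fixes H :: "(complex ^ 'n ^ 'n) measure"
    and \<Omega> :: "'a measure" and \<Lambda> :: "'a \<Rightarrow> complex ^ 'n ^ 'n"
    and P :: "'b measure" and B :: "nat + nat \<Rightarrow> 'b \<Rightarrow> real"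
    and N :: nat
  assumes N: "N = CARD('n)"
    and haar: "haar_prob_unitary H"
    and \<Omega>: "prob_space \<Omega>"
    and \<Lambda>: "\<Lambda> \<in> \<Omega> \<rightarrow>\<^sub>M H" "distr \<Omega> H \<Lambda> = H"
    and P: "prob_space P"
    and indep: "prob_space.indep_vars P (\<lambda>_. borel) B ({1..N} <+> {2..N})"
    and beta1: "\<And>j. j \<in> {1..N} \<Longrightarrow>
      distributed P lborel (B (Inl j)) (\<lambda>x. ennreal (beta_density (real j / 2) (real j / 2) x))"
    and beta2: "\<And>j. j \<in> {2..N} \<Longrightarrow>
      distributed P lborel (B (Inr j))
        (\<lambda>x. ennreal (beta_density ((real j + 1) / 2) ((real j - 1) / 2) x))"
  shows "distr \<Omega> borel (\<lambda>\<omega>. cmod (det (mat 1 - \<Lambda> \<omega>))) =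
         distr P borel (\<lambda>\<omega>. 2 ^ N * (\<Prod>j=1..N. sqrt (B (Inl j) \<omega>)) *
                                     (\<Prod>j=2..N. sqrt (B (Inr j) \<omega>)))"
proof -
  interpret P: prob_space P by (rule P)
  define I where "I = {1..N} <+> {2..N}"
  have fin: "finite I" by (simp add: I_def finite_Plus)
  note X = haar_right_invariant_adjoint[OF haar \<Lambda>]
  note [measurable] = right_invariantD(1)[OF X]
  \<comment> \<open>U and W are the squares of the two sides, so that their k-th moments involve
    only even powers of the modulus and powers of the beta variables without roots.\<close>
  define U where "U \<omega> = (cmod (det_on UNIV (adjoint_mat (\<Lambda> \<omega>))))\<^sup>2" for \<omega>
  define W where "W \<omega> = 4 ^ N * (\<Prod>i\<in>I. B i \<omega>)" for \<omega>
  define m where "m k = (\<Prod>j<N. fact j * fact (j + 2 * k) / (fact (j + k))\<^sup>2 :: real)" for k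
  have B_meas [measurable]: "B i \<in> borel_measurable P" if "i \<in> I" for i
    using indep that by (simp add: P.indep_vars_def I_def)
  have B_AE: "AE \<omega> in P. \<forall>i\<in>I. 0 \<le> B i \<omega> \<and> B i \<omega> \<le> 1"
    unfolding I_def
    by (intro AE_finite_allI fin[unfolded I_def], elim PlusE, hypsubst)
       (blast intro: AE_beta beta1 beta2)+
  have U_meas [measurable]: "U \<in> borel_measurable \<Omega>" unfolding U_def by measurable
  have W_meas [measurable]: "W \<in> borel_measurable P" unfolding W_def by measurable
  \<comment> \<open>Almost surely all beta variables lie in [0,1]. This bounds W and writes its
    powers as products in \<open>ennreal\<close>, where independence is applied.\<close>
  have W_pow: "AE \<omega> in P. 0 \<le> W \<omega> \<and> W \<omega> \<le> 4 ^ N \<and>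
      ennreal (W \<omega> ^ k) = ennreal (4 ^ (N * k)) * (\<Prod>i\<in>I. ennreal (B i \<omega> ^ k))" for k
    using B_AE
  proof eventually_elim
    case (elim \<omega>)
    have "(\<Prod>i\<in>I. ennreal (B i \<omega> ^ k)) = ennreal (\<Prod>i\<in>I. B i \<omega> ^ k)"
      using elim by (intro prod_ennreal) auto
    moreover have "(\<Prod>i\<in>I. B i \<omega>) \<le> 1" using elim by (intro prod_le_1) auto
    moreover have "0 \<le> (\<Prod>i\<in>I. B i \<omega>)" using elim by (intro prod_nonneg) auto
    ultimately show ?case
      by (simp add: W_def power_mult_distrib power_mult prod_power_distrib ennreal_mult')
  qed
  have W_moment: "(\<integral>\<^sup>+\<omega>. ennreal (W \<omega> ^ k) \<partial>P) = ennreal (m k)" for k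
  proof -
    define f where "f i = (case i of Inl j \<Rightarrow> pochhammer (real j / 2) k / pochhammer (real j) k
      | Inr j \<Rightarrow> pochhammer ((real j + 1) / 2) k / pochhammer (real j) k)" for i
    have f0: "0 \<le> f i" if "i \<in> I" for i
      using that by (auto simp: f_def I_def intro!: divide_nonneg_nonneg pochhammer_nonneg)
    have "(\<integral>\<^sup>+\<omega>. ennreal (W \<omega> ^ k) \<partial>P) = (\<integral>\<^sup>+\<omega>. ennreal (4 ^ (N * k)) * (\<Prod>i\<in>I. ennreal (B i \<omega> ^ k)) \<partial>P)"
      by (rule nn_integral_cong_AE) (use W_pow[of k] in eventually_elim, simp)
    also have "\<dots> = ennreal (4 ^ (N * k)) * (\<integral>\<^sup>+\<omega>. (\<Prod>i\<in>I. ennreal (B i \<omega> ^ k)) \<partial>P)"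
      by (rule nn_integral_cmult) measurable
    also have "(\<integral>\<^sup>+\<omega>. (\<Prod>i\<in>I. ennreal (B i \<omega> ^ k)) \<partial>P) = (\<Prod>i\<in>I. \<integral>\<^sup>+\<omega>. ennreal (B i \<omega> ^ k) \<partial>P)"
      by (intro P.indep_vars_nn_integral fin P.indep_vars_compose2[OF indep[folded I_def]]) auto
    also have "\<dots> = (\<Prod>i\<in>I. ennreal (f i))"
    proof (intro prod.cong refl)
      fix i assume "i \<in> I"
      then consider j where "i = Inl j" "j \<in> {1..N}" | j where "i = Inr j" "j \<in> {2..N}" by (auto simp: I_def)
      then show "(\<integral>\<^sup>+\<omega>. ennreal (B i \<omega> ^ k) \<partial>P) = ennreal (f i)"
      proof cases
        case 1
        then show ?thesis using nn_integral_beta_moment[OF beta1[OF 1(2)], of k] by (simp add: f_def)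
      next
        case 2
        \<comment> \<open>The parameters add up to j, as they do in the first family.\<close>
        have "(real j + 1) / 2 + (real j - 1) / 2 = real j" by (simp add: field_simps)
        with 2 show ?thesis using nn_integral_beta_moment[OF beta2[OF 2(2)], of k] by (simp add: f_def)
      qed
    qed
    also have "\<dots> = ennreal (\<Prod>i\<in>I. f i)" using f0 by (intro prod_ennreal) auto
    also have "ennreal (4 ^ (N * k)) * \<dots> = ennreal (4 ^ (N * k) * (\<Prod>i\<in>I. f i))"
      using f0 by (simp add: ennreal_mult prod_nonneg)
    also have "4 ^ (N * k) * (\<Prod>i\<in>I. f i) = m k"
      unfolding I_def m_def prod_pochhammer_halves[symmetric] by (simp add: prod.Plus f_def)
    finally show ?thesis .
  qed
  \<comment> \<open>The growth bound is read off from W \<le> 4^N instead of the factorial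
    formula.\<close>
  have m_le: "m k \<le> (4 ^ N) ^ k" for k
  proof -
    have "ennreal (m k) \<le> (\<integral>\<^sup>+\<omega>. ennreal ((4 ^ N) ^ k) \<partial>P)"
      unfolding W_moment[symmetric]
      by (rule nn_integral_mono_AE) (use W_pow[of k] in eventually_elim, intro ennreal_leI power_mono, simp_all)
    then show ?thesis by (simp add: P.emeasure_space_1)
  qed
  have "distr \<Omega> borel U = distr P borel W"
  proof (rule distr_eq_if_moments_eq[OF \<Omega> P U_meas W_meas, where m = m and c = "4 ^ N"])
    show "(\<integral>\<^sup>+\<omega>. ennreal (U \<omega> ^ k) \<partial>\<Omega>) = ennreal (m k)" for k
      using right_invariant_det_moment[OF \<Omega> X, of k] by (simp add: U_def m_def N power_mult)
    show "AE \<omega> in P. 0 \<le> W \<omega>" using W_pow[of 0] by eventually_elim simp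
  qed (auto simp: U_def m_def W_moment m_le[unfolded m_def] intro!: prod_nonneg)
  \<comment> \<open>Back to the moduli by pushing both laws forward under the square root.\<close>
  then have "distr (distr \<Omega> borel U) borel sqrt = distr (distr P borel W) borel sqrt" by simp
  moreover have "sqrt (U \<omega>) = cmod (det (mat 1 - \<Lambda> \<omega>))" for \<omega>
  proof -
    have "det_on UNIV (\<Lambda> \<omega>) = det (mat 1 - \<Lambda> \<omega>)" by (simp add: det_on_def mat_def cong: if_cong)
    then show ?thesis by (simp add: U_def det_on_adjoint)
  qed
  moreover have "sqrt (W \<omega>) = 2 ^ N * (\<Prod>j=1..N. sqrt (B (Inl j) \<omega>)) * (\<Prod>j=2..N. sqrt (B (Inr j) \<omega>))" for \<omega>
  proof -
    \<comment> \<open>The function \<open>sqrt\<close> is odd and multiplicative on all reals, so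
      the identity holds at every \<omega>, even where some variable is negative.\<close>
    have "sqrt (prod g A) = (\<Prod>i\<in>A. sqrt (g i))" for g and A :: "nat set"
      by (induction A rule: infinite_finite_induct) (simp_all add: real_sqrt_mult)
    moreover have "sqrt (4 ^ N) = 2 ^ N" by (simp add: real_sqrt_power)
    ultimately show ?thesis by (simp add: W_def I_def prod.Plus real_sqrt_mult)
  qed
  ultimately show ?thesis by (simp add: distr_distr comp_def)
qed

end
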